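(* Let $P$ be a $d$-dimensional stacked polytope with $n$ vertices, and let $\Delta(P)$ be its boundary complex. If $d\geq 3$, then for every nonnegative integer $k$, $$b_k(\Delta(P))=(k-1)\binom{n-d}{k}.$$ If $d=2$, then $b_k(\Delta(P))=0$ if $k=n$, and $b_k(\Delta(P))=\frac{n(k-1)}{n-k}\binom{n-2}{k}$ otherwise.
   Context: A simplicial complex $\Delta$ on a finite set $V$ is a collection of subsets of $V$ containing every singleton and closed under taking subsets. For $W\subset V$, $\Delta_W=\{F\cap W:F\in\Delta\}$. Two vertices $u,v\in W$ are connected in $\Delta_W$ if there is a sequence $v=u_0,\ldots,u_r=u$ with $\{u_i,u_{i+1}\}\in\Delta_W$; connected components are maximal nonempty sets of pairwise connected vertices, and $\mathrm{nc}(\Delta_W)$ is their number (so $\mathrm{nc}(\Delta_\emptyset)=0$). Define $b_k(\Delta)=\sum_{W\subset V,\,|W|=k}(\mathrm{nc}(\Delta_W)-1)$ (this equals the graded Betti number $\beta_{k-1,k}$ of the Stanley–Reisner ring for $k\ge1$, and $b_0=-1$). For a simplicial polytope $P$ with vertex set $V$, the boundary complex $\Delta(P)$ is the simplicial complex on $V$ consisting of those $F\subset V$ with $F\neq V$ such that the convex hull of $F$ is a face of $P$. A $d$-dimensional stacked polytope is a simplicial polytope obtained from a $d$-dimensional simplex by finitely many steps, each of which attaches a $d$-dimensional simplex to a facet of the current polytope (i.e., glues a new simplex along that facet, adding one new vertex). *)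

theory Defs
  imports "HOL-Analysis.Polytope"
begin

definition vertex_set :: "'a::euclidean_space set \<Rightarrow> 'a set" where
  "vertex_set P = {v. v extreme_point_of P}"

definition simplicial_polytope :: "'a::euclidean_space set \<Rightarrow> bool" where
  "simplicial_polytope P \<longleftrightarrow>
     polytope P \<and> (\<forall>F. F facet_of P \<longrightarrow> (aff_dim P - 1) simplex F)"

text \<open>
  In the gluing step the union has to be a (convex) simplicial polytope again. The last premise
  of that step says that no old vertex is lost, so that passing from \<open>P\<close> to \<open>P \<union> S\<close> adds
  exactly one vertex, namely the apex of \<open>S\<close> over \<open>F\<close>. It fails, for example, when two triangles
  are glued along an edge to form a larger triangle.
\<close>

inductive stacked_polytope :: "nat \<Rightarrow> 'a::euclidean_space set \<Rightarrow> bool" for d :: nat where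
  simplex: "stacked_polytope d P" if "int d simplex P"
| attach: "stacked_polytope d (P \<union> S)"
    if "stacked_polytope d P"
      and "F facet_of P"
      and "int d simplex S"
      and "F facet_of S"
      and "P \<inter> S = F"
      and "simplicial_polytope (P \<union> S)"
      and "vertex_set (P \<union> S) = vertex_set P \<union> vertex_set S"

definition boundary_complex :: "'a::euclidean_space set \<Rightarrow> 'a set set" where
  "boundary_complex P =
     {F. F \<subseteq> vertex_set P \<and> F \<noteq> vertex_set P \<and> (convex hull F) face_of P}"

text \<open>
  A simplicial complex is represented by its set \<open>\<Delta>\<close> of faces together with its vertex set,
  which is \<open>V\<close> for \<open>\<Delta>\<close> itself and \<open>W\<close> for the restriction to \<open>W \<subseteq> V\<close>.
\<close>

definition restriction :: "'a set set \<Rightarrow> 'a set \<Rightarrow> 'a set set" where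
  "restriction \<Delta> W = {F \<inter> W | F. F \<in> \<Delta>}"

definition connected_in :: "'a set set \<Rightarrow> 'a set \<Rightarrow> 'a \<Rightarrow> 'a \<Rightarrow> bool" where
  "connected_in \<Delta> W u v \<longleftrightarrow>
     u \<in> W \<and> v \<in> W \<and> (\<lambda>x y. {x, y} \<in> restriction \<Delta> W)\<^sup>*\<^sup>* v u"

definition pairwise_connected :: "'a set set \<Rightarrow> 'a set \<Rightarrow> 'a set \<Rightarrow> bool" where
  "pairwise_connected \<Delta> W C \<longleftrightarrow>
     C \<noteq> {} \<and> C \<subseteq> W \<and> (\<forall>u\<in>C. \<forall>v\<in>C. connected_in \<Delta> W u v)"

definition conn_components :: "'a set set \<Rightarrow> 'a set \<Rightarrow> 'a set set" where
  "conn_components \<Delta> W =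
     {C. pairwise_connected \<Delta> W C \<and>
         (\<forall>D. pairwise_connected \<Delta> W D \<and> C \<subseteq> D \<longrightarrow> D = C)}"

definition nc :: "'a set set \<Rightarrow> 'a set \<Rightarrow> nat" where
  "nc \<Delta> W = card (conn_components \<Delta> W)"

definition betti_b :: "nat \<Rightarrow> 'a set \<Rightarrow> 'a set set \<Rightarrow> int" where
  "betti_b k V \<Delta> = (\<Sum>W | W \<subseteq> V \<and> card W = k. int (nc \<Delta> W) - 1)"

end

theory Submission
  imports Defs
begin

text \<open>
  Gluing a simplex with apex \<open>a\<close> to a facet \<open>F\<close> of \<open>P\<close> preserves all proper faces of both pieces
  except \<open>F\<close>, and \<open>a\<close> becomes adjacent exactly to the vertices of \<open>F\<close>. If \<open>d \<ge> 3\<close>, then \<open>F\<close> is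
  not an edge, so \<open>a\<close> is attached to a clique of the old vertex graph: the number of components
  of \<open>W \<union> {a}\<close> exceeds that of \<open>W\<close> only if \<open>W\<close> misses the \<open>d\<close> vertices of \<open>F\<close>. Hence \<open>b\<^sub>k\<close> grows by
  \<open>b\<^sub>k\<^sub>-\<^sub>1 + (n - d choose k - 1)\<close>, and the formula follows from Pascal's rule. If \<open>d = 2\<close>, the step
  subdivides the edge \<open>F\<close>, so the vertex graph is an \<open>n\<close>-cycle. A proper subset \<open>W\<close> of a cycle has as
  many components as there are elements of \<open>W\<close> whose successor is not in \<open>W\<close>, and double counting
  gives \<open>b\<^sub>k = n * (n - 2 choose k - 1) - (n choose k)\<close> for \<open>0 < k < n\<close>.
\<close>

section \<open>Faces of a polytope glued to a simplex\<close>

lemma polytope_finite_vertex_set: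
  fixes P :: "'a::euclidean_space set"
  assumes "polytope P"
  shows "finite (vertex_set P)"
  unfolding vertex_set_def
  by (rule finite_polyhedron_extreme_points[OF polytope_imp_polyhedron[OF assms]])

lemma polytope_eq_convex_hull_vertex_set:
  fixes P :: "'a::euclidean_space set"
  assumes "polytope P"
  shows "P = convex hull (vertex_set P)"
  unfolding vertex_set_def
  by (rule Krein_Milman_Minkowski[OF polytope_imp_compact[OF assms] polytope_imp_convex[OF assms]])

lemma vertex_set_convex_hull_affine_independent:
  fixes C :: "'a::euclidean_space set"
  assumes "\<not> affine_dependent C"
  shows "vertex_set (convex hull C) = C"
  using extreme_point_of_convex_hull_affine_independent[OF assms] by (auto simp: vertex_set_def)

lemma simplex_vertex_set:
  fixes S :: "'a::euclidean_space set"
  assumes "n simplex S"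
  shows "\<not> affine_dependent (vertex_set S)" "int (card (vertex_set S)) = n + 1"
    "S = convex hull (vertex_set S)"
proof -
  obtain C where C: "\<not> affine_dependent C" "int (card C) = n + 1" "S = convex hull C"
    using assms unfolding simplex_def by blast
  then have "vertex_set S = C"
    using vertex_set_convex_hull_affine_independent by blast
  with C show "\<not> affine_dependent (vertex_set S)" "int (card (vertex_set S)) = n + 1"
    "S = convex hull (vertex_set S)" by auto
qed

lemma vertex_set_face:
  "T face_of P \<Longrightarrow> vertex_set T = vertex_set P \<inter> T"
  unfolding vertex_set_def using extreme_point_of_face by blast

lemma vertex_set_subset: "vertex_set P \<subseteq> P"
  by (auto simp: vertex_set_def extreme_point_of_def)

lemma simplex_subset_face:
  fixes S :: "'a::euclidean_space set"
  assumes "n simplex S" and "A \<subseteq> vertex_set S"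
  shows "convex hull A face_of S"
  using face_of_convex_hull_affine_independent[OF simplex_vertex_set(1)[OF assms(1)]]
    simplex_vertex_set(3)[OF assms(1)] assms(2) by metis

lemma simplex_facet_simplex:
  fixes S :: "'a::euclidean_space set"
  assumes "n simplex S" and "F facet_of S"
  obtains a where "a \<in> vertex_set S" "vertex_set F = vertex_set S - {a}" "(n - 1) simplex F"
proof -
  let ?C = "vertex_set S"
  have ind: "\<not> affine_dependent ?C" by (rule simplex_vertex_set(1)[OF assms(1)])
  have "F facet_of convex hull ?C"
    using assms simplex_vertex_set(3)[OF assms(1)] by simp
  then obtain a where a: "a \<in> ?C" "F = convex hull (?C - {a})"
    using facet_of_convex_hull_affine_independent[OF ind] by blast
  have ind': "\<not> affine_dependent (?C - {a})"
    using ind affine_independent_Diff by blast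
  have "card ?C = Suc (card (?C - {a}))"
    using a(1) aff_independent_finite[OF ind] by (metis card.remove)
  then have "(n - 1) simplex F"
    unfolding simplex_def using ind' a simplex_vertex_set(2)[OF assms(1)] by force
  moreover have "vertex_set F = ?C - {a}"
    using a(2) ind' vertex_set_convex_hull_affine_independent by blast
  ultimately show thesis using that a by blast
qed

lemma simplex_imp_simplicial_polytope:
  fixes S :: "'a::euclidean_space set"
  assumes "n simplex S"
  shows "simplicial_polytope S"
  unfolding simplicial_polytope_def aff_dim_simplex[OF assms]
  using simplex_imp_polytope[OF assms] simplex_facet_simplex[OF assms] by blast

text \<open>A nonempty proper face lies in a facet; that facet is a simplex, any set of whose
  vertices spans a face, and faces of faces are faces.\<close>

lemma simplicial_polytope_subset_face:
  fixes P :: "'a::euclidean_space set"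
  assumes "simplicial_polytope P" "T face_of P" "T \<noteq> P" "A \<subseteq> vertex_set P \<inter> T"
  shows "convex hull A face_of P"
proof (cases "T = {}")
  case True
  with assms(4) show ?thesis by simp
next
  case False
  obtain G where G: "G facet_of P" "T \<subseteq> G"
    using face_of_polyhedron_subset_facet[OF _ assms(2) False assms(3)] assms(1)
      polytope_imp_polyhedron unfolding simplicial_polytope_def by blast
  have "A \<subseteq> vertex_set G"
    using vertex_set_face[OF facet_of_imp_face_of[OF G(1)]] assms(4) G(2) by blast
  then have "convex hull A face_of G"
    using assms(1) G(1) simplex_subset_face unfolding simplicial_polytope_def by blast
  then show ?thesis
    using G(1) facet_of_imp_face_of face_of_trans by blast
qed

text \<open>A minimal face containing \<open>z\<close> works: were \<open>z\<close> on its relative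
  boundary, a facet of that face would contain \<open>z\<close> and be a smaller face.\<close>

lemma polytope_face_rel_interior:
  fixes P :: "'a::euclidean_space set"
  assumes "polytope P" "z \<in> P"
  obtains T where "T face_of P" "z \<in> rel_interior T"
proof -
  let ?A = "{T. T face_of P \<and> z \<in> T}"
  have "finite ?A" using finite_polytope_faces[OF assms(1)] by simp
  moreover have "P \<in> ?A" using assms face_of_refl polytope_imp_convex by blast
  ultimately obtain T where T: "T \<in> ?A" "\<And>T'. T' \<in> ?A \<Longrightarrow> T' \<subseteq> T \<Longrightarrow> T = T'"
    using finite_has_minimal[of ?A] by blast
  have "polyhedron T"
    using T(1) assms(1) face_of_polytope_polytope polytope_imp_polyhedron by blast
  have "z \<in> rel_interior T"
  proof (rule ccontr)
    assume "z \<notin> rel_interior T"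
    then obtain G where "G facet_of T" "z \<in> G"
      using rel_boundary_of_polyhedron[OF \<open>polyhedron T\<close>] T(1) by blast
    then have "G \<in> ?A" "G \<subseteq> T" "G \<noteq> T"
      using T(1) facet_of_imp_face_of face_of_trans facet_of_imp_subset facet_of_irrefl by blast+
    then show False using T(2) by blast
  qed
  then show thesis using that T(1) by blast
qed

section \<open>The vertex graph of a polytope\<close>

text \<open>Phrased by faces of \<open>P\<close> rather than by \<open>boundary_complex P\<close>,
  so that edges before and after a gluing can be compared face by face;
  \<open>restriction_boundary_complex_pair\<close> links the two.\<close>

definition vertex_adjacent :: "'a::euclidean_space set \<Rightarrow> 'a \<Rightarrow> 'a \<Rightarrow> bool" where
  "vertex_adjacent P x y \<longleftrightarrow> convex hull {x, y} face_of P"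

lemma vertex_adjacent_commute: "vertex_adjacent P x y \<longleftrightarrow> vertex_adjacent P y x"
  by (simp add: vertex_adjacent_def insert_commute)

lemma aff_dim_convex_hull_pair_le:
  fixes x y :: "'a::euclidean_space"
  shows "aff_dim (convex hull {x, y}) \<le> 1"
  by (simp add: aff_dim_convex_hull aff_dim_2)

lemma vertex_set_convex_hull_pair:
  fixes x y :: "'a::euclidean_space"
  shows "vertex_set (convex hull {x, y}) = {x, y}"
  by (auto simp: vertex_set_def extreme_point_of_convex_hull_2)

text \<open>A member \<open>G\<close> of the complex with trace \<open>{x, y}\<close> on
  \<open>W\<close> may have further vertices, but in a simplicial polytope every subset of its
  vertices spans a face. Conversely, the bound of three vertices keeps \<open>{x, y}\<close> from
  being the excluded full vertex set.\<close>

lemma restriction_boundary_complex_pair: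
  fixes P :: "'a::euclidean_space set"
  assumes "simplicial_polytope P" "card (vertex_set P) \<ge> 3" "W \<subseteq> vertex_set P" "x \<in> W" "y \<in> W"
  shows "{x, y} \<in> restriction (boundary_complex P) W \<longleftrightarrow> vertex_adjacent P x y"
proof
  assume "{x, y} \<in> restriction (boundary_complex P) W"
  then obtain G where G: "G \<subseteq> vertex_set P" "G \<noteq> vertex_set P" "convex hull G face_of P" "{x, y} = G \<inter> W"
    unfolding restriction_def boundary_complex_def by blast
  have "convex hull G \<noteq> P"
  proof
    assume "convex hull G = P"
    then have "vertex_set P \<subseteq> G"
      using extreme_point_of_convex_hull unfolding vertex_set_def by blast
    with G show False by blast
  qed
  moreover have "{x, y} \<subseteq> vertex_set P \<inter> convex hull G"
    using G(1,4) hull_subset[of G convex] by blast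
  ultimately show "vertex_adjacent P x y"
    unfolding vertex_adjacent_def using simplicial_polytope_subset_face[OF assms(1) G(3)] by blast
next
  assume "vertex_adjacent P x y"
  moreover have "card {x, y} < 3"
    by (simp add: card_insert_if)
  then have "{x, y} \<noteq> vertex_set P" using assms(2) by auto
  ultimately have "{x, y} \<in> boundary_complex P"
    using assms(3-5) by (auto simp: boundary_complex_def vertex_adjacent_def)
  moreover have "{x, y} = {x, y} \<inter> W" using assms by blast
  ultimately show "{x, y} \<in> restriction (boundary_complex P) W"
    unfolding restriction_def by blast
qed

section \<open>One attaching step\<close>

text \<open>Here \<open>P\<close> enters only as a polytope of dimension \<open>d\<close>, so the
  geometry of a single step is separated from the inductions over stacked polytopes.\<close>

locale simplex_gluing =
  fixes P S F :: "'a::euclidean_space set" and d :: nat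
  assumes polytope_P: "polytope P" and dim_P: "aff_dim P = int d"
    and facet_P: "F facet_of P"
    and simplex_S: "int d simplex S"
    and facet_S: "F facet_of S"
    and inter: "P \<inter> S = F"
    and simplicial_union: "simplicial_polytope (P \<union> S)"
    and vertices_union: "vertex_set (P \<union> S) = vertex_set P \<union> vertex_set S"
begin

lemma polytope_union: "polytope (P \<union> S)"
  using simplicial_union by (simp add: simplicial_polytope_def)

lemma convex_union: "convex (P \<union> S)"
  by (rule polytope_imp_convex[OF polytope_union])

text \<open>The segment lies in the convex union and is covered by two closed sets that both meet
  it; by connectedness it meets their intersection \<open>F\<close>, and its endpoints are outside
  \<open>F\<close>.\<close>

lemma segment_crosses_facet:
  assumes "p \<in> P - F" "q \<in> S - F"
  obtains w where "w \<in> F" "w \<in> open_segment p q"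
proof -
  let ?s = "closed_segment p q"
  have "?s \<subseteq> P \<union> S"
    using assms convex_union by (intro closed_segment_subset) auto
  moreover have "closed P" "closed S"
    using polytope_P simplex_S polytope_imp_closed closed_simplex by blast+
  moreover have "P \<inter> ?s \<noteq> {}" "S \<inter> ?s \<noteq> {}" using assms by auto
  moreover have "connected ?s" by simp
  ultimately have "P \<inter> S \<inter> ?s \<noteq> {}"
    unfolding connected_closed by blast
  then obtain w where "w \<in> F" "w \<in> ?s" using inter by blast
  moreover from this have "w \<noteq> p" "w \<noteq> q" using assms by auto
  ultimately show thesis using that by (auto simp: open_segment_def)
qed

lemma dim_S: "aff_dim S = int d"
  using simplex_S by (rule aff_dim_simplex)

lemma proper_facet: "P - F \<noteq> {}" "S - F \<noteq> {}"
proof -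
  show "P - F \<noteq> {}"
    using facet_P facet_of_imp_subset facet_of_irrefl by (metis Diff_eq_empty_iff subset_antisym)
  show "S - F \<noteq> {}"
    using facet_S facet_of_imp_subset facet_of_irrefl by (metis Diff_eq_empty_iff subset_antisym)
qed

text \<open>Fix \<open>p\<close> in \<open>P - F\<close>. For \<open>q\<close> in
  \<open>S - F\<close> the segment from \<open>p\<close> crosses \<open>F\<close> at some
  \<open>w\<close>, and \<open>q\<close> lies on the line through \<open>p\<close> and
  \<open>w\<close>, hence in the affine hull of \<open>P\<close>. Equal dimensions turn the
  inclusion into equality.\<close>

lemma affine_hull_S: "affine hull S = affine hull P"
proof -
  obtain p where p: "p \<in> P - F" using proper_facet by blast
  have "q \<in> affine hull P" if q: "q \<in> S" for q
  proof (cases "q \<in> F")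
    case True
    then show ?thesis using inter hull_inc by (metis IntD1)
  next
    case False
    then obtain w where w: "w \<in> F" "w \<in> open_segment p q"
      using segment_crosses_facet[OF p, of q] q by blast
    then obtain u where u: "0 < u" "u < 1" "w = (1 - u) *\<^sub>R p + u *\<^sub>R q"
      by (auto simp: in_segment)
    have "q = (1 - 1 / u) *\<^sub>R p + (1 / u) *\<^sub>R w"
      unfolding u(3) using u(1) by (simp add: algebra_simps)
    moreover have "p \<in> affine hull P" "w \<in> affine hull P"
      using p w(1) inter hull_inc by fast+
    ultimately show ?thesis
      using mem_affine[OF affine_affine_hull, of p P w "1 - 1 / u" "1 / u"] by simp
  qed
  then have "affine hull S \<subseteq> affine hull P"
    by (meson affine_affine_hull hull_minimal subsetI)
  moreover have "affine hull S \<noteq> {}" using proper_facet by auto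
  ultimately show ?thesis
    using affine_dim_equal[of "affine hull S" "affine hull P"] dim_S dim_P by simp
qed

lemma affine_hull_union: "affine hull (P \<union> S) = affine hull P"
proof
  have "S \<subseteq> affine hull P" using affine_hull_S hull_subset by metis
  then show "affine hull (P \<union> S) \<subseteq> affine hull P"
    by (simp add: hull_minimal hull_subset)
qed (simp add: hull_mono)

lemma dim_union: "aff_dim (P \<union> S) = int d"
  using affine_hull_union dim_P by (metis aff_dim_affine_hull)

text \<open>The segment meets \<open>F\<close>, so if it were a face, its intersection with
  \<open>F\<close> would be a nonempty face of \<open>F\<close> and have a vertex \<open>v\<close>.
  By \<open>vertices_union\<close>, \<open>v\<close> stays a vertex of the union, hence is an
  endpoint of the segment; but both endpoints avoid \<open>F\<close>.\<close>

lemma segment_not_face: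
  assumes "x \<in> vertex_set P - F" "a \<in> vertex_set S - F"
  shows "\<not> convex hull {x, a} face_of P \<union> S"
proof
  let ?K = "convex hull {x, a}"
  assume K: "?K face_of P \<union> S"
  obtain w where w: "w \<in> F" "w \<in> open_segment x a"
    using segment_crosses_facet assms vertex_set_subset by blast
  have "polytope F"
    using facet_P facet_of_imp_face_of face_of_polytope_polytope polytope_P by blast
  have "F \<subseteq> P \<union> S" using inter by blast
  then have "?K \<inter> F face_of F"
    using face_of_slice[OF K polytope_imp_convex[OF \<open>polytope F\<close>]] by (simp add: Int_absorb1)
  moreover have "w \<in> ?K \<inter> F"
    using w by (simp add: open_segment_def segment_convex_hull)
  ultimately obtain v where "v \<in> vertex_set (?K \<inter> F)"
    using polytope_eq_convex_hull_vertex_set \<open>polytope F\<close> face_of_polytope_polytope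
    by (metis convex_hull_eq_empty emptyE equals0I)
  then have v: "v \<in> ?K" "v \<in> F" "v \<in> vertex_set F"
    using vertex_set_face[OF \<open>?K \<inter> F face_of F\<close>] by auto
  then have "v \<in> vertex_set (P \<union> S)"
    using vertex_set_face[OF facet_of_imp_face_of[OF facet_P]] vertices_union by blast
  then have "v \<in> vertex_set ?K"
    using vertex_set_face[OF K] v by blast
  then show False
    using v assms by (auto simp: vertex_set_convex_hull_pair)
qed

lemma facet_not_face: "\<not> F face_of P \<union> S"
proof
  assume F: "F face_of P \<union> S"
  obtain p q where pq: "p \<in> P - F" "q \<in> S - F" using proper_facet by blast
  then obtain w where "w \<in> F" "w \<in> open_segment p q" using segment_crosses_facet by blast
  then show False using face_ofD[OF F] pq by blast
qed

text \<open>A face contained in neither piece has a vertex outside \<open>S\<close> and one outside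
  \<open>P\<close>. As the union is simplicial, these two would span an edge, contrary to
  \<open>segment_not_face\<close>.\<close>

lemma proper_face_of_union:
  assumes T: "T face_of P \<union> S" "T \<noteq> P \<union> S"
  shows "T \<subseteq> P \<or> T \<subseteq> S"
proof (rule ccontr)
  assume *: "\<not> (T \<subseteq> P \<or> T \<subseteq> S)"
  have polyT: "polytope T" using T(1) polytope_union face_of_polytope_polytope by blast
  have "\<not> vertex_set T \<subseteq> P" "\<not> vertex_set T \<subseteq> S"
    using * polytope_eq_convex_hull_vertex_set[OF polyT] hull_minimal[of "vertex_set T"]
      polytope_imp_convex[OF polytope_P] convex_simplex[OF simplex_S] by metis+
  then obtain x a where xa: "x \<in> vertex_set T" "x \<notin> S" "a \<in> vertex_set T" "a \<notin> P" by blast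
  then have "x \<in> vertex_set P - F" "a \<in> vertex_set S - F"
    using vertex_set_face[OF T(1)] vertices_union inter vertex_set_subset[of P] vertex_set_subset[of S] by blast+
  moreover have "{x, a} \<subseteq> vertex_set (P \<union> S) \<inter> T"
    using xa vertex_set_face[OF T(1)] by auto
  then have "convex hull {x, a} face_of P \<union> S"
    by (rule simplicial_polytope_subset_face[OF simplicial_union T])
  ultimately show False using segment_not_face by blast
qed

text \<open>
  For \<open>z\<close> in the relative interior of \<open>K\<close>, the only face of \<open>P \<union> S\<close> having \<open>z\<close> in its relative
  interior lies in \<open>P\<close> or in \<open>S\<close>, so it must be \<open>K\<close>.
\<close>

lemma face_of_union:
  assumes K: "K face_of P \<or> K face_of S" and ne: "K \<noteq> {}" "K \<noteq> F" "K \<noteq> P" "K \<noteq> S"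
  shows "K face_of P \<union> S"
proof -
  have convS: "convex S" using simplex_S convex_simplex by blast
  have convP: "convex P" using polytope_P polytope_imp_convex by blast
  have FP: "F face_of P" and FS: "F face_of S"
    using facet_P facet_S facet_of_imp_face_of by auto
  have "convex K" using K face_of_imp_convex by blast
  then obtain z where z: "z \<in> rel_interior K" using ne rel_interior_eq_empty by blast
  then have zK: "z \<in> K" using rel_interior_subset by blast
  \<comment> \<open>A face of a convex set that meets the relative interior of a subset contains
    that subset, so \<open>F\<close> absorbs \<open>K\<close>.\<close>
  have inF: "K face_of F" if "z \<in> F"
  proof -
    have "K \<subseteq> F" using K
    proof
      assume "K face_of P"
      then show ?thesis using subset_of_face_of[OF FP face_of_imp_subset] z that by blast
    next
      assume "K face_of S"
      then show ?thesis using subset_of_face_of[OF FS face_of_imp_subset] z that by blast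
    qed
    then show ?thesis using K face_of_face FP FS by metis
  qed
  obtain T where T: "T face_of P \<union> S" "z \<in> rel_interior T"
    using polytope_face_rel_interior[OF polytope_union] zK K face_of_imp_subset by (metis UnCI subsetD)
  then have zT: "z \<in> T" using rel_interior_subset by blast
  \<comment> \<open>Otherwise a relative neighbourhood of \<open>z\<close> lies in the union. For
    \<open>z\<close> in \<open>F\<close> this puts \<open>z\<close> in the relative interior of
    \<open>F\<close> and gives \<open>K = F\<close>; for \<open>z\<close> in one piece only, it
    gives that \<open>K\<close> is that piece. Both are excluded by \<open>ne\<close>.\<close>
  have "T \<noteq> P \<union> S"
  proof
    assume "T = P \<union> S"
    then obtain e where e: "e > 0" "ball z e \<inter> affine hull P \<subseteq> P \<union> S"
      using T(2) affine_hull_union by (auto simp: mem_rel_interior_ball)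
    show False
    proof (cases "z \<in> F")
      case True
      have "affine hull F \<subseteq> affine hull P"
        using FP face_of_imp_subset hull_mono by metis
      moreover have "F = affine hull F \<inter> P" "F = affine hull F \<inter> S"
        using face_of_imp_eq_affine_Int FP FS convP convS by blast+
      ultimately have "ball z e \<inter> affine hull F \<subseteq> F" using e(2) by blast
      then have "z \<in> rel_interior F" using True e(1) by (auto simp: mem_rel_interior_ball)
      then have "K = F"
        using face_of_eq[OF inF[OF True] face_of_refl] face_of_imp_convex[OF FP] z by blast
      with ne show False by blast
    next
      case False
      consider "z \<in> P" "z \<notin> S" | "z \<in> S" "z \<notin> P" using False zK K face_of_imp_subset inter by blast
      then show False
      proof cases
        case 1
        have "open (- S)" using simplex_S closed_simplex by blast
        \<comment> \<open>Shrinking the ball to avoid the closed set \<open>S\<close> leaves a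
          relative neighbourhood of \<open>z\<close> inside \<open>P\<close> alone.\<close>
        then obtain r where r: "r > 0" "ball z r \<subseteq> - S" using 1 by (auto simp: open_contains_ball)
        moreover have "ball z (min e r) \<subseteq> ball z e" "ball z (min e r) \<subseteq> ball z r" by auto
        ultimately have "ball z (min e r) \<inter> affine hull P \<subseteq> P" using e(2) by blast
        then have "z \<in> rel_interior P"
          using 1 e(1) r(1) by (auto simp: mem_rel_interior_ball intro!: exI[of _ "min e r"])
        moreover have "K face_of P"
          using K 1 face_of_imp_subset zK by blast
        ultimately show False
          using face_of_eq[OF _ face_of_refl[OF convP]] z ne by blast
      next
        case 2
        have "open (- P)" using polytope_P polytope_imp_closed by blast
        then obtain r where r: "r > 0" "ball z r \<subseteq> - P" using 2 by (auto simp: open_contains_ball)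
        moreover have "ball z (min e r) \<subseteq> ball z e" "ball z (min e r) \<subseteq> ball z r" by auto
        ultimately have "ball z (min e r) \<inter> affine hull S \<subseteq> S" using e(2) unfolding affine_hull_S by blast
        then have "z \<in> rel_interior S"
          using 2 e(1) r(1) by (auto simp: mem_rel_interior_ball intro!: exI[of _ "min e r"])
        moreover have "K face_of S"
          using K 2 face_of_imp_subset zK by blast
        ultimately show False
          using face_of_eq[OF _ face_of_refl[OF convS]] z ne by blast
      qed
    qed
  qed
  then consider "T \<subseteq> P" | "T \<subseteq> S" using proper_face_of_union T(1) by blast
  then have "T face_of P \<or> T face_of S"
    using face_of_subset[OF T(1)] by cases auto
  moreover have "T = K" if "K face_of X" "T face_of X" for X
    using face_of_eq[OF that(2,1)] T(2) z by blast
  \<comment> \<open>Possibly \<open>T\<close> and \<open>K\<close> are faces of different pieces.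
    Then \<open>z\<close> is in both pieces, hence in \<open>F\<close>, and \<open>K\<close> is a
    face of \<open>F\<close> and so of each piece.\<close>
  moreover have "K face_of P \<and> K face_of S" if "T face_of X" "X = P \<or> X = S" "\<not> K face_of X" for X
  proof -
    have "z \<in> F" using that K zT zK face_of_imp_subset inter by blast
    then show ?thesis using inF face_of_trans FP FS by blast
  qed
  ultimately have "T = K" by blast
  then show ?thesis using T by blast
qed

text \<open>The description is determinate because a facet of a simplex omits exactly one
  vertex.\<close>

definition apex :: 'a where
  "apex = (THE a. a \<in> vertex_set S - F)"

lemma apex: "vertex_set S - F = {apex}"
proof -
  obtain a where a: "a \<in> vertex_set S" "vertex_set F = vertex_set S - {a}"
    using simplex_facet_simplex[OF simplex_S facet_S] by blast
  have "vertex_set F = vertex_set S \<inter> F"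
    using vertex_set_face facet_S facet_of_imp_face_of by blast
  with a have "vertex_set S - F = {a}" by blast
  then show ?thesis unfolding apex_def by (auto intro: theI2)
qed

lemma apex_notin: "apex \<notin> vertex_set P" "apex \<notin> F" "apex \<notin> P"
proof -
  show "apex \<notin> F" using apex by blast
  then show "apex \<notin> P" using apex inter vertex_set_subset by blast
  then show "apex \<notin> vertex_set P" using vertex_set_subset by blast
qed

lemma vertex_set_facet: "vertex_set F = vertex_set P \<inter> F" "vertex_set F = vertex_set S - {apex}"
proof -
  show "vertex_set F = vertex_set P \<inter> F"
    using vertex_set_face facet_P facet_of_imp_face_of by blast
  have "vertex_set F = vertex_set S \<inter> F"
    using vertex_set_face facet_S facet_of_imp_face_of by blast
  then show "vertex_set F = vertex_set S - {apex}" using apex by blast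
qed

lemma vertex_set_union: "vertex_set (P \<union> S) = insert apex (vertex_set P)"
proof -
  have "vertex_set S - {apex} \<subseteq> vertex_set P" "apex \<in> vertex_set S"
    using vertex_set_facet apex by blast+
  then show ?thesis unfolding vertices_union by blast
qed

lemma card_vertex_set_facet: "card (vertex_set F) = d"
proof -
  have "finite (vertex_set S)"
    using simplex_S simplex_imp_polytope polytope_finite_vertex_set by blast
  moreover have "apex \<in> vertex_set S" using apex by blast
  moreover have "card (vertex_set S) = Suc d"
    using simplex_vertex_set(2)[OF simplex_S] by simp
  ultimately show ?thesis using vertex_set_facet(2) by simp
qed

text \<open>A segment from the apex to a vertex off \<open>F\<close> is ruled out by
  \<open>segment_not_face\<close>. A segment to a vertex of \<open>F\<close> is a face of
  \<open>S\<close> that contains the apex, so it is neither \<open>F\<close> nor \<open>P\<close>,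
  and for \<open>d \<ge> 2\<close> it is too small to be \<open>S\<close>; it therefore survives in
  the union.\<close>

lemma vertex_adjacent_apex:
  assumes "d \<ge> 2" "x \<in> vertex_set P"
  shows "vertex_adjacent (P \<union> S) apex x \<longleftrightarrow> x \<in> F"
proof
  assume "vertex_adjacent (P \<union> S) apex x"
  then have "convex hull {x, apex} face_of P \<union> S"
    by (simp add: vertex_adjacent_def insert_commute)
  then show "x \<in> F" using segment_not_face assms(2) apex by blast
next
  let ?K = "convex hull {apex, x}"
  assume "x \<in> F"
  then have "{apex, x} \<subseteq> vertex_set S" using vertex_set_facet assms(2) apex by blast
  then have "?K face_of S" using simplex_S simplex_subset_face by blast
  moreover have "apex \<in> ?K" by (simp add: hull_inc)
  then have "?K \<noteq> F" "?K \<noteq> P" "?K \<noteq> {}" using apex_notin by auto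
  moreover have "?K \<noteq> S"
    using aff_dim_convex_hull_pair_le[of apex x] dim_S assms(1) by auto
  ultimately show "vertex_adjacent (P \<union> S) apex x"
    unfolding vertex_adjacent_def using face_of_union by blast
qed

text \<open>Among the proper nonempty faces only \<open>F\<close> is lost, so an old edge disappears
  exactly when it is \<open>F\<close> itself.\<close>

lemma vertex_adjacent_union:
  assumes "d \<ge> 2" "x \<in> vertex_set P" "y \<in> vertex_set P"
  shows "vertex_adjacent (P \<union> S) x y \<longleftrightarrow> vertex_adjacent P x y \<and> vertex_set F \<noteq> {x, y}"
proof
  let ?K = "convex hull {x, y}"
  assume K: "vertex_adjacent (P \<union> S) x y"
  have "?K \<subseteq> P"
    using assms vertex_set_subset polytope_imp_convex[OF polytope_P] by (intro hull_minimal) auto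
  then have "?K face_of P"
    using K face_of_subset unfolding vertex_adjacent_def by blast
  moreover have "F = ?K" if "vertex_set F = {x, y}"
    using that polytope_eq_convex_hull_vertex_set facet_P facet_of_imp_face_of
      face_of_polytope_polytope polytope_P by metis
  ultimately show "vertex_adjacent P x y \<and> vertex_set F \<noteq> {x, y}"
    using K facet_not_face unfolding vertex_adjacent_def by blast
next
  let ?K = "convex hull {x, y}"
  assume K: "vertex_adjacent P x y \<and> vertex_set F \<noteq> {x, y}"
  then have "?K \<noteq> F" using vertex_set_convex_hull_pair by blast
  moreover have "?K \<noteq> P" "?K \<noteq> S"
    using aff_dim_convex_hull_pair_le[of x y] dim_S dim_P assms(1) by auto
  ultimately show "vertex_adjacent (P \<union> S) x y"
    using face_of_union K unfolding vertex_adjacent_def by auto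
qed

lemma vertex_adjacent_facet:
  assumes "x \<in> vertex_set F" "y \<in> vertex_set F"
  shows "vertex_adjacent P x y"
proof -
  have "{x, y} \<subseteq> vertex_set F" using assms by blast
  moreover have "(int d - 1) simplex F"
    using simplex_facet_simplex[OF simplex_S facet_S] by blast
  ultimately have "convex hull {x, y} face_of F" using simplex_subset_face by blast
  then show ?thesis
    unfolding vertex_adjacent_def using facet_P facet_of_imp_face_of face_of_trans by blast
qed

end

section \<open>Components of induced subgraphs\<close>

text \<open>Membership in \<open>W\<close> is required separately because the reflexive closure
  relates points outside \<open>W\<close> to themselves; with it this is an equivalence relation on
  \<open>W\<close>.\<close>

definition reach :: "('a \<Rightarrow> 'a \<Rightarrow> bool) \<Rightarrow> 'a set \<Rightarrow> ('a \<times> 'a) set" where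
  "reach E W = {(u, v). u \<in> W \<and> v \<in> W \<and> (\<lambda>x y. x \<in> W \<and> y \<in> W \<and> E x y)\<^sup>*\<^sup>* u v}"

definition ncomp :: "('a \<Rightarrow> 'a \<Rightarrow> bool) \<Rightarrow> 'a set \<Rightarrow> nat" where
  "ncomp E W = card (W // reach E W)"

lemma equiv_reach:
  assumes "symp E"
  shows "equiv W (reach E W)"
proof (rule equivI)
  have *: "symp (\<lambda>x y. x \<in> W \<and> y \<in> W \<and> E x y)"
    using assms unfolding symp_def by blast
  show "sym (reach E W)"
    unfolding sym_def reach_def using symp_rtranclp[OF *] by (auto dest: sympD)
  show "trans (reach E W)"
    unfolding trans_def reach_def by auto
qed (auto simp: refl_on_def reach_def)

lemma reach_edge: "x \<in> W \<Longrightarrow> y \<in> W \<Longrightarrow> E x y \<Longrightarrow> (x, y) \<in> reach E W"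
  unfolding reach_def by auto

lemma reach_mono: "W \<subseteq> W' \<Longrightarrow> reach E W \<subseteq> reach E W'"
proof (clarsimp simp: reach_def, intro conjI)
  fix u v assume W: "W \<subseteq> W'" "u \<in> W" "v \<in> W" "(\<lambda>x y. x \<in> W \<and> y \<in> W \<and> E x y)\<^sup>*\<^sup>* u v"
  show "(\<lambda>x y. x \<in> W' \<and> y \<in> W' \<and> E x y)\<^sup>*\<^sup>* u v"
    by (rule rtranclp_mono[THEN predicate2D, OF _ W(4)]) (use W(1) in blast)
qed auto

text \<open>Loops are absorbed by the reflexive closure, so only distinct pairs have to be
  compared.\<close>

lemma ncomp_cong:
  assumes "\<And>x y. x \<in> W \<Longrightarrow> y \<in> W \<Longrightarrow> x \<noteq> y \<Longrightarrow> E x y = E' x y"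
  shows "ncomp E W = ncomp E' W"
proof -
  have R: "(\<lambda>x y. x \<in> W \<and> y \<in> W \<and> E x y)\<^sup>=\<^sup>= = (\<lambda>x y. x \<in> W \<and> y \<in> W \<and> E' x y)\<^sup>=\<^sup>="
    using assms by (intro ext) auto
  have "(\<lambda>x y. x \<in> W \<and> y \<in> W \<and> E x y)\<^sup>*\<^sup>* = (\<lambda>x y. x \<in> W \<and> y \<in> W \<and> E' x y)\<^sup>*\<^sup>*"
    using arg_cong[OF R, of rtranclp] by simp
  then show ?thesis by (simp add: ncomp_def reach_def)
qed

lemma ncomp_empty [simp]: "ncomp E {} = 0"
  by (simp add: ncomp_def)

lemma ncomp_eq_1:
  assumes "W \<noteq> {}" "\<And>x y. x \<in> W \<Longrightarrow> y \<in> W \<Longrightarrow> (x, y) \<in> reach E W"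
  shows "ncomp E W = 1"
proof -
  have "reach E W `` {x} = W" if "x \<in> W" for x
    using assms(2)[OF that] by (auto simp: reach_def)
  then have "W // reach E W = {W}"
    using assms(1) unfolding quotient_def by auto
  then show ?thesis by (simp add: ncomp_def)
qed

lemma reach_if_ncomp_eq_1:
  assumes "symp E" "ncomp E W = 1" "x \<in> W" "y \<in> W"
  shows "(x, y) \<in> reach E W"
proof -
  obtain C where "W // reach E W = {C}"
    using assms(2) by (auto simp: ncomp_def card_1_singleton_iff)
  then have "reach E W `` {x} = reach E W `` {y}"
    using quotientI[of _ W "reach E W"] assms(3,4) by (metis singletonD)
  then show ?thesis
    using eq_equiv_class[OF _ equiv_reach[OF assms(1)] assms(4)] by blast
qed

text \<open>By \<open>nb\<close>, the neighbours of \<open>a\<close> in \<open>W\<close> lie in a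
  single class. If there is one, \<open>a\<close> joins that class and no classes merge; if there is
  none, \<open>{a}\<close> is a new class.\<close>

lemma ncomp_insert:
  assumes E: "symp E" and W: "finite W" "a \<notin> W"
    and nb: "\<And>x y. x \<in> W \<Longrightarrow> y \<in> W \<Longrightarrow> E a x \<Longrightarrow> E a y \<Longrightarrow> (x, y) \<in> reach E W"
  shows "ncomp E (insert a W) = ncomp E W + (if \<exists>x\<in>W. E a x then 0 else 1)"
proof -
  let ?R = "reach E W" and ?R' = "reach E (insert a W)"
  let ?s = "\<lambda>x y. x \<in> insert a W \<and> y \<in> insert a W \<and> E x y"
  have eq: "equiv W ?R" and eq': "equiv (insert a W) ?R'" using equiv_reach[OF E] by auto
  have sub: "?R \<subseteq> ?R'" by (rule reach_mono) blast
  have rangeR: "?R \<subseteq> W \<times> W" unfolding reach_def by blast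
  have rangeR': "?R' \<subseteq> insert a W \<times> insert a W" unfolding reach_def by blast
  have symE: "E x y \<Longrightarrow> E y x" for x y using E by (auto dest: sympD)
  show ?thesis
  proof (cases "\<exists>x\<in>W. E a x")
    case True
    then obtain n where n: "n \<in> W" "E a n" by blast
    \<comment> \<open>A retraction of \<open>insert a W\<close> onto \<open>W\<close> that replaces
      \<open>a\<close> by one of its neighbours; it preserves and reflects reachability.\<close>
    define f where "f = (\<lambda>x. if x = a then n else x)"
    have fW: "f x \<in> W" if "x \<in> insert a W" for x using that n by (auto simp: f_def)
    have refl: "(x, x) \<in> ?R" if "x \<in> W" for x using that eq by (auto simp: reach_def)
    have step: "(f x, f y) \<in> ?R" if "?s x y" for x y
      using that n nb[of n y] nb[of x n] symE[of x y] W(2) refl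
      by (auto simp: f_def intro: reach_edge)
    have 1: "(f u, f v) \<in> ?R" if "(u, v) \<in> ?R'" for u v
    proof -
      have "?s\<^sup>*\<^sup>* u v" "u \<in> insert a W" using that unfolding reach_def by auto
      then show ?thesis
      proof (induction rule: rtranclp_induct)
        case base
        then show ?case using refl fW by blast
      next
        case (step y z)
        then show ?case using \<open>\<And>x y. ?s x y \<Longrightarrow> (f x, f y) \<in> ?R\<close>[of y z] eq
          by (meson equivE transD)
      qed
    qed
    have fR': "(x, f x) \<in> ?R'" if "x \<in> insert a W" for x
      using that n by (auto simp: f_def intro: reach_edge) (auto simp: reach_def)
    have 2: "(u, v) \<in> ?R'" if "u \<in> insert a W" "v \<in> insert a W" "(f u, f v) \<in> ?R" for u v
      using fR'[OF that(1)] fR'[OF that(2)] sub that(3) eq'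
      by (meson equivE symE symD transD subsetD)
    \<comment> \<open>Pulling classes back along \<open>f\<close> matches old classes with new ones;
      intersecting with \<open>W\<close> undoes it, whence injectivity.\<close>
    define g where "g = (\<lambda>C. {v \<in> insert a W. f v \<in> C})"
    have cls: "?R' `` {u} = g (?R `` {f u})" if "u \<in> insert a W" for u
    proof -
      have "(u, v) \<in> ?R' \<longleftrightarrow> v \<in> insert a W \<and> (f u, f v) \<in> ?R" for v
        using 1[of u v] 2[OF that, of v] rangeR' by blast
      then show ?thesis unfolding g_def by blast
    qed
    have "insert a W // ?R' = (\<lambda>u. ?R' `` {u}) ` insert a W"
      unfolding quotient_def by auto
    also have "\<dots> = (\<lambda>u. g (?R `` {f u})) ` insert a W"
      using cls by (intro image_cong) auto
    also have "\<dots> = g ` (\<lambda>u. ?R `` {u}) ` f ` insert a W"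
      by (simp add: image_image)
    also have "f ` insert a W = W"
      using n(1) W(2) by (auto simp: f_def)
    also have "(\<lambda>u. ?R `` {u}) ` W = W // ?R"
      unfolding quotient_def by auto
    finally have quot: "insert a W // ?R' = g ` (W // ?R)" .
    have "g C \<inter> W = C" if "C \<in> W // ?R" for C
      using that rangeR W(2) unfolding g_def f_def quotient_def by auto
    then have "inj_on g (W // ?R)" by (metis inj_onI)
    then have "ncomp E (insert a W) = ncomp E W"
      unfolding ncomp_def quot by (rule card_image)
    then show ?thesis using True by simp
  next
    case False
    have 1: "u = v \<or> (u, v) \<in> ?R" if "(u, v) \<in> ?R'" for u v
    proof -
      have "?s\<^sup>*\<^sup>* u v" "u \<in> insert a W" using that unfolding reach_def by auto
      then show ?thesis
      proof (induction rule: rtranclp_induct)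
        case (step y z)
        have "y = z \<or> (y, z) \<in> ?R"
          using step(2) False symE[of y z] by (auto intro: reach_edge)
        with step.IH[OF step.prems] show ?case using eq by (metis equivE transD)
      qed simp
    qed
    have "(a, v) \<notin> ?R" for v using rangeR W(2) by blast
    then have "?R' `` {a} = {a}" using 1 by (auto simp: reach_def)
    moreover have "?R' `` {u} = ?R `` {u}" if "u \<in> W" for u
      using 1 sub that by (auto simp: reach_def)
    ultimately have "insert a W // ?R' = insert {a} (W // ?R)"
      unfolding quotient_def by auto
    moreover have "{a} \<notin> W // ?R"
      using rangeR W(2) unfolding quotient_def by blast
    moreover have "finite (W // ?R)"
      using W(1) unfolding quotient_def by simp
    ultimately show ?thesis using False by (simp add: ncomp_def)
  qed
qed

section \<open>Agreement with the components of a restricted complex\<close>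

text \<open>Any set of pairwise related elements lies in the class of each of its members, so
  maximality forces equality. The left side has the shape to which \<open>conn_components\<close>
  unfolds.\<close>

lemma maximal_pairwise_related_eq_quotient:
  assumes "equiv W R"
  shows "{C. (C \<noteq> {} \<and> C \<subseteq> W \<and> C \<times> C \<subseteq> R) \<and>
      (\<forall>D. (D \<noteq> {} \<and> D \<subseteq> W \<and> D \<times> D \<subseteq> R) \<and> C \<subseteq> D \<longrightarrow> D = C)} = W // R"
  (is "{C. ?p C \<and> ?m C} = _")
proof (intro set_eqI iffI)
  fix C assume "C \<in> {C. ?p C \<and> ?m C}"
  then have p: "?p C" and m: "?m C" by auto
  then obtain x where x: "x \<in> C" "x \<in> W" by blast
  have "C \<subseteq> R `` {x}" using p x by blast
  moreover have "R `` {x} \<times> R `` {x} \<subseteq> R"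
    using assms by (auto elim!: equivE dest: symD transD)
  moreover have "R `` {x} \<subseteq> W" "x \<in> R `` {x}"
    using assms x by (auto elim!: equivE dest: refl_onD)
  ultimately have "R `` {x} = C" using m[rule_format, of "R `` {x}"] by blast
  then show "C \<in> W // R" using x(2) by (auto intro: quotientI)
next
  fix C assume "C \<in> W // R"
  then obtain x where x: "x \<in> W" "C = R `` {x}" by (auto elim: quotientE)
  have "x \<in> C" using x assms equiv_class_self by fast
  have "C \<times> C \<subseteq> R" "C \<subseteq> W"
    unfolding x(2) using assms by (auto elim!: equivE dest: symD transD)
  moreover have "D = C" if "D \<times> D \<subseteq> R" "C \<subseteq> D" for D
    using that x \<open>x \<in> C\<close> by blast
  ultimately show "C \<in> {C. ?p C \<and> ?m C}" using \<open>x \<in> C\<close> by blast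
qed

lemma nc_eq_ncomp:
  assumes E: "symp E"
    and edges: "\<And>x y. x \<in> W \<Longrightarrow> y \<in> W \<Longrightarrow> {x, y} \<in> restriction \<Delta> W \<longleftrightarrow> E x y"
  shows "nc \<Delta> W = ncomp E W"
proof -
  \<comment> \<open>Members of \<open>restriction \<Delta> W\<close> are subsets of
    \<open>W\<close>, so edges cannot leave \<open>W\<close>.\<close>
  have "(\<lambda>x y. {x, y} \<in> restriction \<Delta> W) = (\<lambda>x y. x \<in> W \<and> y \<in> W \<and> E x y)"
    using edges by (intro ext) (auto simp: restriction_def)
  then have "connected_in \<Delta> W u v \<longleftrightarrow> (v, u) \<in> reach E W" for u v
    unfolding connected_in_def reach_def by auto
  then have "pairwise_connected \<Delta> W C \<longleftrightarrow> C \<noteq> {} \<and> C \<subseteq> W \<and> C \<times> C \<subseteq> reach E W" for C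
    unfolding pairwise_connected_def by blast
  then have "conn_components \<Delta> W = W // reach E W"
    unfolding conn_components_def
    using maximal_pairwise_related_eq_quotient[OF equiv_reach[OF E, of W]] by simp
  then show ?thesis by (simp add: nc_def ncomp_def)
qed

section \<open>The sums \<open>b_k\<close> of a graph\<close>

text \<open>The graph version of \<open>betti_b\<close>: \<open>b_k\<close> sees only the edges of
  the complex.\<close>

definition excess_sum :: "('a \<Rightarrow> 'a \<Rightarrow> bool) \<Rightarrow> 'a set \<Rightarrow> nat \<Rightarrow> int" where
  "excess_sum E V k = (\<Sum>W | W \<subseteq> V \<and> card W = k. int (ncomp E W) - 1)"

lemma excess_sum_cong:
  assumes "\<And>x y. x \<in> V \<Longrightarrow> y \<in> V \<Longrightarrow> x \<noteq> y \<Longrightarrow> E x y = E' x y"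
  shows "excess_sum E V k = excess_sum E' V k"
  unfolding excess_sum_def
proof (rule sum.cong[OF refl])
  fix W assume "W \<in> {W. W \<subseteq> V \<and> card W = k}"
  then have "ncomp E W = ncomp E' W" using assms by (intro ncomp_cong) blast
  then show "int (ncomp E W) - 1 = int (ncomp E' W) - 1" by simp
qed

lemma excess_sum_0:
  assumes "finite V"
  shows "excess_sum E V 0 = - 1"
proof -
  \<comment> \<open>Finiteness of \<open>V\<close> matters since infinite sets also have
    \<open>card\<close> equal to 0.\<close>
  have "{W. W \<subseteq> V \<and> card W = 0} = {{}}"
    using assms finite_subset by fastforce
  then show ?thesis by (simp add: excess_sum_def)
qed

lemma excess_sum_complete:
  assumes "\<And>x y. x \<in> V \<Longrightarrow> y \<in> V \<Longrightarrow> E x y"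
  shows "excess_sum E V (Suc k) = 0"
  unfolding excess_sum_def
proof (rule sum.neutral, rule ballI)
  fix W assume W: "W \<in> {W. W \<subseteq> V \<and> card W = Suc k}"
  then have "W \<noteq> {}" "W \<subseteq> V" by auto
  then have "ncomp E W = 1"
    using assms by (intro ncomp_eq_1 reach_edge) auto
  then show "int (ncomp E W) - 1 = 0" by simp
qed

text \<open>Split the sets of size \<open>k + 1\<close> by whether they contain \<open>a\<close>.
  Those that do are \<open>insert a W\<close> with \<open>W\<close> of size \<open>k\<close>; since
  the neighbours of \<open>a\<close> form a clique, \<open>a\<close> adds a component exactly when
  \<open>W\<close> misses \<open>C\<close>, and the binomial coefficient counts these
  \<open>W\<close>.\<close>

lemma excess_sum_insert_clique:
  assumes E: "symp E" and V: "finite V" "a \<notin> V" and C: "C \<subseteq> V"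
    and clique: "\<And>x y. x \<in> C \<Longrightarrow> y \<in> C \<Longrightarrow> E x y"
    and nb: "\<And>x. x \<in> V \<Longrightarrow> E a x \<longleftrightarrow> x \<in> C"
  shows "excess_sum E (insert a V) (Suc k) =
    excess_sum E V (Suc k) + excess_sum E V k + int ((card V - card C) choose k)"
proof -
  let ?A = "\<lambda>j. {W. W \<subseteq> V \<and> card W = j}"
  have finA: "finite (?A j)" for j
    using V(1) by (auto intro: finite_subset[of _ "Pow V"])
  have fin: "finite W" if "W \<subseteq> V" for W using that V(1) finite_subset by blast
  have split: "{W. W \<subseteq> insert a V \<and> card W = Suc k} = ?A (Suc k) \<union> insert a ` ?A k"
  proof (intro set_eqI iffI)
    fix W assume W: "W \<in> {W. W \<subseteq> insert a V \<and> card W = Suc k}"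
    show "W \<in> ?A (Suc k) \<union> insert a ` ?A k"
    proof (cases "a \<in> W")
      case True
      then have "W = insert a (W - {a})" "W - {a} \<in> ?A k" using W by auto
      then show ?thesis by blast
    qed (use W in auto)
  next
    fix W assume "W \<in> ?A (Suc k) \<union> insert a ` ?A k"
    then show "W \<in> {W. W \<subseteq> insert a V \<and> card W = Suc k}"
    proof
      assume "W \<in> insert a ` ?A k"
      then obtain U where U: "U \<subseteq> V" "card U = k" "W = insert a U" by blast
      moreover have "a \<notin> U" using U(1) V(2) by blast
      ultimately show ?thesis using fin[OF U(1)] by auto
    qed auto
  qed
  have inj: "inj_on (insert a) (?A k)"
    using V(2) by (intro inj_onI) (metis (mono_tags, lifting) insert_ident mem_Collect_eq subsetD)
  have ins: "ncomp E (insert a W) = ncomp E W + (if W \<inter> C = {} then 1 else 0)" if "W \<subseteq> V" for W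
  proof -
    have "ncomp E (insert a W) = ncomp E W + (if \<exists>x\<in>W. E a x then 0 else 1)"
      using that V(2) nb clique by (intro ncomp_insert[OF E fin[OF that]] reach_edge) blast+
    moreover have "(\<exists>x\<in>W. E a x) \<longleftrightarrow> W \<inter> C \<noteq> {}" using nb that by blast
    ultimately show ?thesis by simp
  qed
  have "excess_sum E (insert a V) (Suc k) =
      excess_sum E V (Suc k) + (\<Sum>W\<in>insert a ` ?A k. int (ncomp E W) - 1)"
    unfolding excess_sum_def split using finA V(2) by (intro sum.union_disjoint) auto
  also have "(\<Sum>W\<in>insert a ` ?A k. int (ncomp E W) - 1) =
      (\<Sum>W\<in>?A k. (int (ncomp E W) - 1) + (if W \<inter> C = {} then 1 else 0))"
    unfolding sum.reindex[OF inj] by (intro sum.cong) (auto simp: ins)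
  also have "\<dots> = excess_sum E V k + (\<Sum>W\<in>?A k. if W \<inter> C = {} then 1 else 0)"
    by (simp add: sum.distrib excess_sum_def)
  also have "(\<Sum>W\<in>?A k. if W \<inter> C = {} then 1 else 0) = int (card {W \<in> ?A k. W \<inter> C = {}})"
    using finA by (simp flip: sum.inter_filter)
  also have "{W \<in> ?A k. W \<inter> C = {}} = {W. W \<subseteq> V - C \<and> card W = k}" by blast
  also have "card \<dots> = (card V - card C) choose k"
    using V(1) C by (simp add: n_subsets card_Diff_subset finite_subset)
  finally show ?thesis by simp
qed

section \<open>Cycles and their induced subgraphs\<close>

text \<open>Loops are left unconstrained, because \<open>convex hull {x}\<close> is a face as well.\<close>

definition cyclic_enum :: "('a \<Rightarrow> 'a \<Rightarrow> bool) \<Rightarrow> (nat \<Rightarrow> 'a) \<Rightarrow> nat \<Rightarrow> 'a set \<Rightarrow> bool" where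
  "cyclic_enum E c n V \<longleftrightarrow> bij_betw c {..<n} V \<and>
     (\<forall>i<n. \<forall>j<n. i \<noteq> j \<longrightarrow> (E (c i) (c j) \<longleftrightarrow> j = Suc i mod n \<or> i = Suc j mod n))"

lemma bij_betw_add_mod:
  fixes n k :: nat
  shows "bij_betw (\<lambda>i. (i + k) mod n) {..<n} {..<n}"
proof (cases "n = 0")
  case False
  have "inj_on (\<lambda>i. (i + k) mod n) {..<n}"
  proof (rule inj_onI)
    fix i j assume ij: "i \<in> {..<n}" "j \<in> {..<n}" "(i + k) mod n = (j + k) mod n"
    then obtain p q where "i + k + n * p = j + k + n * q"
      unfolding nat_mod_eq_iff by blast
    then have "i + n * p = j + n * q" by simp
    then have "i mod n = j mod n" unfolding nat_mod_eq_iff by blast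
    then show "i = j" using ij by simp
  qed
  moreover have "(\<lambda>i. (i + k) mod n) ` {..<n} \<subseteq> {..<n}" using False by auto
  ultimately show ?thesis
    by (simp add: bij_betw_def endo_inj_surj)
qed (auto simp: bij_betw_def)

text \<open>Shifting indices commutes with the successor modulo \<open>n\<close>. This permits
  cutting the cycle open at any chosen place.\<close>

lemma cyclic_enum_rotate:
  assumes "cyclic_enum E c n V"
  shows "cyclic_enum E (\<lambda>i. c ((i + k) mod n)) n V"
  unfolding cyclic_enum_def
proof (intro conjI allI impI)
  have "bij_betw c {..<n} V" using assms by (simp add: cyclic_enum_def)
  from bij_betw_trans[OF bij_betw_add_mod this]
  show "bij_betw (\<lambda>i. c ((i + k) mod n)) {..<n} V" by (simp add: comp_def)
  fix i j assume ij: "i < n" "j < n" "i \<noteq> j"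
  have inj: "(x + k) mod n = (y + k) mod n \<longleftrightarrow> x = y" if "x < n" "y < n" for x y
    using bij_betw_add_mod[of k n] that inj_on_eq_iff[of "\<lambda>i. (i + k) mod n" "{..<n}" x y]
    by (simp add: bij_betw_def)
  have suc: "Suc ((x + k) mod n) mod n = (Suc x mod n + k) mod n" for x
    by (simp add: mod_simps)
  have n: "0 < n" using ij by auto
  have "E (c ((i + k) mod n)) (c ((j + k) mod n)) \<longleftrightarrow>
      (j + k) mod n = Suc ((i + k) mod n) mod n \<or> (i + k) mod n = Suc ((j + k) mod n) mod n"
    using assms ij inj[of i j] n unfolding cyclic_enum_def by simp
  also have "\<dots> \<longleftrightarrow> j = Suc i mod n \<or> i = Suc j mod n"
    unfolding suc using inj[of j "Suc i mod n"] inj[of i "Suc j mod n"] ij n by simp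
  finally show "E (c ((i + k) mod n)) (c ((j + k) mod n)) \<longleftrightarrow> j = Suc i mod n \<or> i = Suc j mod n" .
qed

text \<open>As \<open>m < n\<close>, the last index is left out, so the wraparound edge plays no
  part and the components are runs of consecutive elements. Each run is counted by its last
  element.\<close>

lemma ncomp_initial_segment:
  assumes E: "symp E" and c: "cyclic_enum E c n V" and "m < n" "W \<subseteq> c ` {..<m}"
  shows "ncomp E W = card {i. i < m \<and> c i \<in> W \<and> c (Suc i) \<notin> W}"
  using assms(3,4)
proof (induction m arbitrary: W)
  case 0
  then show ?case by simp
next
  case (Suc m)
  have inj: "c i = c j \<longleftrightarrow> i = j" if "i < n" "j < n" for i j
    using c that unfolding cyclic_enum_def bij_betw_def inj_on_def by auto
  show ?case
  proof (cases "c m \<in> W")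
    case False
    then have "W \<subseteq> c ` {..<m}"
      using Suc.prems(2) by (auto simp: lessThan_Suc)
    then have "ncomp E W = card {i. i < m \<and> c i \<in> W \<and> c (Suc i) \<notin> W}"
      using Suc.IH Suc.prems(1) by simp
    also have "{i. i < m \<and> c i \<in> W \<and> c (Suc i) \<notin> W} = {i. i < Suc m \<and> c i \<in> W \<and> c (Suc i) \<notin> W}"
      using False by (auto simp: less_Suc_eq)
    finally show ?thesis .
  next
    case True
    define U where "U = W - {c m}"
    have U: "U \<subseteq> c ` {..<m}" "c m \<notin> U" "W = insert (c m) U"
      using Suc.prems(2) True by (auto simp: U_def lessThan_Suc)
    then have "finite U" by (auto intro: finite_subset)
    have nb: "E (c m) x \<longleftrightarrow> (\<exists>i. Suc i = m \<and> x = c i)" if x: "x \<in> U" for x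
    proof -
      obtain j where j: "j < m" "x = c j" using x U(1) by blast
      have "E (c m) (c j) \<longleftrightarrow> j = Suc m mod n \<or> m = Suc j mod n"
        using c j(1) Suc.prems(1) unfolding cyclic_enum_def by simp
      \<comment> \<open>Because \<open>Suc m < n\<close>, neither successor wraps around; only the
        predecessor of \<open>m\<close> can be a neighbour in \<open>U\<close>.\<close>
      also have "\<dots> \<longleftrightarrow> Suc j = m" using j(1) Suc.prems(1) by auto
      also have "\<dots> \<longleftrightarrow> (\<exists>i. Suc i = m \<and> x = c i)"
      proof -
        have "c j = c i \<longleftrightarrow> j = i" if "Suc i = m" for i
          using inj[of j i] j(1) that Suc.prems(1) by simp
        then show ?thesis unfolding j(2) by metis
      qed
      finally show ?thesis using j(2) by simp
    qed
    have "ncomp E W = ncomp E U + (if \<exists>x\<in>U. E (c m) x then 0 else 1)"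
      unfolding U(3)
    proof (rule ncomp_insert[OF E \<open>finite U\<close> U(2)])
      fix x y assume "x \<in> U" "y \<in> U" "E (c m) x" "E (c m) y"
      then have "x = y" using nb by auto
      then show "(x, y) \<in> reach E U" using \<open>x \<in> U\<close> by (simp add: reach_def)
    qed
    also have "(\<exists>x\<in>U. E (c m) x) \<longleftrightarrow> (\<exists>i. Suc i = m \<and> c i \<in> U)"
      using nb by blast
    also have "ncomp E U = card {i. i < m \<and> c i \<in> U \<and> c (Suc i) \<notin> U}" (is "_ = card ?B")
      using Suc.IH Suc.prems(1) U(1) by simp
    finally have eq: "ncomp E W = card ?B + (if \<exists>i. Suc i = m \<and> c i \<in> U then 0 else 1)" .
    have mU: "c (Suc m) \<notin> W"
    proof
      assume "c (Suc m) \<in> W"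
      then obtain j where "j < Suc m" "c (Suc m) = c j" using Suc.prems(2) by blast
      then show False using inj[of "Suc m" j] Suc.prems(1) by auto
    qed
    have W: "c i \<in> W \<longleftrightarrow> c i \<in> U \<or> i = m" if "i < n" for i
      using inj[OF that, of m] Suc.prems(1) U(3) by auto
    \<comment> \<open>Adding \<open>c m\<close> creates the run end \<open>m\<close> and cancels the
      run end just before it, if there was one.\<close>
    have set: "{i. i < Suc m \<and> c i \<in> W \<and> c (Suc i) \<notin> W} = insert m (?B - {i. Suc i = m})"
      using mU W Suc.prems(1) by (auto simp: less_Suc_eq)
    have fin: "finite ?B" by simp
    show ?thesis
    proof (cases "\<exists>i. Suc i = m \<and> c i \<in> U")
      case True
      then obtain i where i: "Suc i = m" "c i \<in> U" by blast
      then have "i \<in> ?B" using U(2) by auto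
      moreover have "{j. Suc j = m} = {i}" using i(1) by auto
      ultimately show ?thesis
        unfolding eq set using True fin card_gt_0_iff[of ?B] by (auto simp: card_Diff_singleton)
    next
      case False
      then have "?B - {i. Suc i = m} = ?B" by auto
      then show ?thesis unfolding eq set using False by simp
    qed
  qed
qed

text \<open>Rotating a missing element to the last index reduces the cycle to a path; the count of
  run ends is then carried back along the rotation.\<close>

lemma ncomp_proper_subset:
  assumes E: "symp E" and c: "cyclic_enum E c n V" and W: "W \<subseteq> V" "W \<noteq> V"
  shows "ncomp E W = card {i. i < n \<and> c i \<in> W \<and> c (Suc i mod n) \<notin> W}"
proof -
  have V: "V = c ` {..<n}" using c by (simp add: cyclic_enum_def bij_betw_def)
  then obtain j where j: "j < n" "c j \<notin> W" using W by blast
  then obtain m where m: "n = Suc m" using gr0_implies_Suc by (metis less_nat_zero_code not_gr_zero)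
  \<comment> \<open>The shift by \<open>Suc j\<close> sends the last index \<open>m = n - 1\<close>
    to \<open>j\<close>, the index of an element outside \<open>W\<close>.\<close>
  define r where "r = (\<lambda>i. (i + Suc j) mod n)"
  have c': "cyclic_enum E (\<lambda>i. c (r i)) n V"
    unfolding r_def by (rule cyclic_enum_rotate[OF c])
  have "m + Suc j = j + n" using m by simp
  then have "r m = j" unfolding r_def using j(1) by (simp only: mod_add_self2 mod_less)
  then have last: "c (r m) \<notin> W" using j by simp
  have "V = (\<lambda>i. c (r i)) ` {..<n}" using c' by (simp add: cyclic_enum_def bij_betw_def)
  then have "W \<subseteq> (\<lambda>i. c (r i)) ` {..<m}"
    using W(1) last unfolding m by (auto simp: lessThan_Suc)
  then have "ncomp E W = card {i. i < m \<and> c (r i) \<in> W \<and> c (r (Suc i)) \<notin> W}"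
    using ncomp_initial_segment[OF E c', of m W] m by simp
  \<comment> \<open>Index \<open>m\<close> contributes nothing because \<open>c (r m)\<close> is not
    in \<open>W\<close>, so the range may be extended to \<open>n\<close>.\<close>
  also have "{i. i < m \<and> c (r i) \<in> W \<and> c (r (Suc i)) \<notin> W} =
      {i. i < n \<and> c (r i) \<in> W \<and> c (Suc (r i) mod n) \<notin> W}" (is "_ = ?A")
  proof -
    have "r (Suc i) = Suc (r i) mod n" for i by (simp add: r_def mod_simps)
    then show ?thesis using last m by (auto simp: less_Suc_eq)
  qed
  also have "card ?A = card (r ` ?A)"
  proof (rule card_image[symmetric])
    show "inj_on r ?A"
      using bij_betw_add_mod[of "Suc j" n] unfolding r_def bij_betw_def
      by (auto intro: inj_on_subset)
  qed
  also have "r ` ?A = {i. i < n \<and> c i \<in> W \<and> c (Suc i mod n) \<notin> W}"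
  proof -
    have "r ` {..<n} = {..<n}"
      using bij_betw_add_mod[of "Suc j" n] unfolding r_def bij_betw_def by auto
    moreover have "r ` {i \<in> {..<n}. Q (r i)} = {i \<in> r ` {..<n}. Q i}" for Q by blast
    ultimately have "r ` {i \<in> {..<n}. Q (r i)} = {i \<in> {..<n}. Q i}" for Q by simp
    from this[of "\<lambda>i. c i \<in> W \<and> c (Suc i mod n) \<notin> W"] show ?thesis by simp
  qed
  finally show ?thesis .
qed

text \<open>The full cycle has no run end, so it is treated separately: dropping the last element
  leaves a single run, and that element is adjacent to \<open>c 0\<close>.\<close>

lemma ncomp_whole_cycle:
  assumes E: "symp E" and c: "cyclic_enum E c n V" and n: "n \<ge> 2"
  shows "ncomp E V = 1"
proof -
  obtain m where m: "n = Suc (Suc m)" using n by (metis Suc_le_D numeral_2_eq_2 Suc_le_mono)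
  define W where "W = c ` {..<Suc m}"
  have inj: "c i = c j \<longleftrightarrow> i = j" if "i < n" "j < n" for i j
    using c that unfolding cyclic_enum_def bij_betw_def inj_on_def by auto
  have V: "V = insert (c (Suc m)) W"
    using c unfolding cyclic_enum_def bij_betw_def m W_def by (auto simp: lessThan_Suc)
  have mem: "c i \<in> W \<longleftrightarrow> i < Suc m" if "i < n" for i
  proof -
    have "c i \<in> W \<longleftrightarrow> (\<exists>j<Suc m. c i = c j)" unfolding W_def by auto
    also have "\<dots> \<longleftrightarrow> (\<exists>j<Suc m. i = j)"
    proof -
      have "c i = c j \<longleftrightarrow> i = j" if "j < Suc m" for j
        using inj[of i j] \<open>i < n\<close> that m by simp
      then show ?thesis by blast
    qed
    finally show ?thesis by simp
  qed
  have "i < Suc m \<and> c i \<in> W \<and> c (Suc i) \<notin> W \<longleftrightarrow> i = m" for i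
    using mem[of i] mem[of "Suc i"] unfolding m by (cases "i < Suc m") auto
  then have "{i. i < Suc m \<and> c i \<in> W \<and> c (Suc i) \<notin> W} = {m}" by simp
  then have one: "ncomp E W = 1"
    using ncomp_initial_segment[OF E c, of "Suc m" W] m by (simp add: W_def)
  have "E (c (Suc m)) (c 0)"
    using c m unfolding cyclic_enum_def by simp
  moreover have "c 0 \<in> W" by (simp add: W_def)
  moreover have "ncomp E V = ncomp E W + (if \<exists>x\<in>W. E (c (Suc m)) x then 0 else 1)"
    unfolding V
    by (rule ncomp_insert[OF E]) (use mem m reach_if_ncomp_eq_1[OF E one] in \<open>auto simp: W_def\<close>)
  ultimately show ?thesis using one by auto
qed

text \<open>Rotate until the edge to be subdivided joins positions \<open>0\<close> and
  \<open>n - 1\<close>, that is, until it is the wraparound edge; the new vertex then takes position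
  \<open>n\<close>.\<close>

lemma cyclic_enum_subdivide:
  assumes E': "symp E'" and c: "cyclic_enum E c n V" and n: "n \<ge> 3"
    and fg: "f \<in> V" "g \<in> V" "f \<noteq> g" "E f g" and a: "a \<notin> V"
    and old: "\<And>x y. x \<in> V \<Longrightarrow> y \<in> V \<Longrightarrow> x \<noteq> y \<Longrightarrow> E' x y \<longleftrightarrow> E x y \<and> {f, g} \<noteq> {x, y}"
    and new: "\<And>x. x \<in> V \<Longrightarrow> E' a x \<longleftrightarrow> x \<in> {f, g}"
  obtains c' where "cyclic_enum E' c' (Suc n) (insert a V)"
proof -
  have "\<exists>e. cyclic_enum E e n V \<and> {e 0, e (n - 1)} = {f, g}"
  proof -
    have V: "V = c ` {..<n}" using c by (simp add: cyclic_enum_def bij_betw_def)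
    obtain i j where ij: "i < n" "j < n" "f = c i" "g = c j" using fg V by blast
    then have "i \<noteq> j" using fg(3) by blast
    then have "j = Suc i mod n \<or> i = Suc j mod n"
      using c ij fg(4) unfolding cyclic_enum_def by blast
    \<comment> \<open>The shift by \<open>Suc p\<close> puts the successor of \<open>c p\<close>
      first and \<open>c p\<close> last.\<close>
    moreover have "\<exists>e. cyclic_enum E e n V \<and> e 0 = c (Suc p mod n) \<and> e (n - 1) = c p" if "p < n" for p
    proof (intro exI conjI)
      show "cyclic_enum E (\<lambda>i. c ((i + Suc p mod n) mod n)) n V" by (rule cyclic_enum_rotate[OF c])
      have "(n - 1 + Suc p mod n) mod n = (n - 1 + Suc p) mod n" by (rule mod_add_right_eq)
      also have "n - 1 + Suc p = n + p" using n by simp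
      finally show "c ((n - 1 + Suc p mod n) mod n) = c p" using that by simp
    qed simp
    ultimately show ?thesis using ij by (metis insert_commute)
  qed
  then obtain e where e: "cyclic_enum E e n V" "{e 0, e (n - 1)} = {f, g}" by blast
  define c' where "c' = e(n := a)"
  have bij: "bij_betw e {..<n} V" using e by (simp add: cyclic_enum_def)
  have inj: "e i = e j \<longleftrightarrow> i = j" if "i < n" "j < n" for i j
    using bij that unfolding bij_betw_def inj_on_def by auto
  have eV: "e i \<in> V" if "i < n" for i using bij that unfolding bij_betw_def by auto
  have bij': "bij_betw c' {..<Suc n} (insert a V)"
  proof -
    have "bij_betw c' {..<n} V"
      using bij bij_betw_cong[of "{..<n}" e c' V] by (simp add: c'_def)
    moreover have "c' n = a" by (simp add: c'_def)
    ultimately show ?thesis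
      using notIn_Un_bij_betw[of n "{..<n}" c' V] a by (simp add: lessThan_Suc)
  qed
  have lt: "E' (c' i) (c' j) \<longleftrightarrow> j = Suc i mod Suc n \<or> i = Suc j mod Suc n"
    if "i < j" "j < Suc n" for i j
  proof (cases "j = n")
    case True
    have "E' (e i) a \<longleftrightarrow> e i \<in> {e 0, e (n - 1)}"
      unfolding e(2) using new[OF eV] that True E' by (metis sympD)
    also have "\<dots> \<longleftrightarrow> i = 0 \<or> i = n - 1"
      using inj[of i] that True n by simp
    finally show ?thesis
      using True that by (auto simp: c'_def)
  next
    case False
    then have ij: "i < n" "j < n" using that by auto
    \<comment> \<open>The deleted edge is exactly the wraparound pair, which for
      \<open>n \<ge> 3\<close> is not also a pair of consecutive positions.\<close>
    have "{e 0, e (n - 1)} = {e i, e j} \<longleftrightarrow> i = 0 \<and> j = n - 1"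
      using inj ij that n by (auto simp: doubleton_eq_iff)
    moreover have "E (e i) (e j) \<longleftrightarrow> j = Suc i mod n \<or> i = Suc j mod n"
      using e(1) ij that unfolding cyclic_enum_def by simp
    moreover have "j = Suc i mod n \<longleftrightarrow> j = Suc i" using ij that by auto
    moreover have "i = Suc j mod n \<longleftrightarrow> i = 0 \<and> j = n - 1"
      using ij that by (cases "Suc j = n") auto
    ultimately have "E' (e i) (e j) \<longleftrightarrow> j = Suc i"
      using old[OF eV[OF ij(1)] eV[OF ij(2)]] inj[OF ij] that n e(2) by auto
    then show ?thesis using ij that by (auto simp: c'_def)
  qed
  have "cyclic_enum E' c' (Suc n) (insert a V)"
    unfolding cyclic_enum_def
  proof (intro conjI bij' allI impI)
    fix i j assume ij: "i < Suc n" "j < Suc n" "i \<noteq> j"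
    have "E' (c' i) (c' j) \<longleftrightarrow> E' (c' j) (c' i)" using E' by (auto dest: sympD)
    then show "E' (c' i) (c' j) \<longleftrightarrow> j = Suc i mod Suc n \<or> i = Suc j mod Suc n"
      using lt[of i j] lt[of j i] ij by (cases "i < j") auto
  qed
  then show thesis by (rule that)
qed

section \<open>Double counting on a cycle\<close>

lemma card_subsets_containing_avoiding:
  assumes "finite V" "x \<in> V" "y \<in> V" "x \<noteq> y"
  shows "card {W. W \<subseteq> V \<and> card W = Suc k \<and> x \<in> W \<and> y \<notin> W} = (card V - 2) choose k"
proof -
  let ?B = "{B. B \<subseteq> V - {x, y} \<and> card B = k}"
  have "{W. W \<subseteq> V \<and> card W = Suc k \<and> x \<in> W \<and> y \<notin> W} = insert x ` ?B"
  proof (intro set_eqI iffI)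
    fix W assume W: "W \<in> {W. W \<subseteq> V \<and> card W = Suc k \<and> x \<in> W \<and> y \<notin> W}"
    then have "W = insert x (W - {x})" "W - {x} \<in> ?B" by auto
    then show "W \<in> insert x ` ?B" by blast
  next
    fix W assume "W \<in> insert x ` ?B"
    then obtain B where B: "B \<subseteq> V - {x, y}" "card B = k" "W = insert x B" by blast
    then have "finite B" "x \<notin> B" using assms(1) finite_subset by blast+
    then show "W \<in> {W. W \<subseteq> V \<and> card W = Suc k \<and> x \<in> W \<and> y \<notin> W}"
      using B assms by auto
  qed
  moreover have "inj_on (insert x) ?B"
  proof (rule inj_onI)
    fix A B assume "A \<in> ?B" "B \<in> ?B" and eq: "insert x A = insert x B"
    then have "x \<notin> A" "x \<notin> B" by auto
    then show "A = B" using eq by (simp add: insert_ident)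
  qed
  moreover have "card (V - {x, y}) = card V - 2" using assms by (simp add: card_Diff_subset)
  ultimately show ?thesis
    using assms(1) by (simp add: card_image n_subsets)
qed

text \<open>Exchange the sums over \<open>W\<close> and over run ends: for each \<open>i\<close>,
  the sets of size \<open>k + 1\<close> containing \<open>c i\<close> but not its successor number
  \<open>(n - 2) choose k\<close>. Subtracting 1 for each \<open>W\<close> gives the second binomial
  coefficient.\<close>

lemma excess_sum_cycle:
  assumes E: "symp E" and c: "cyclic_enum E c n V" and n: "n \<ge> 2" "Suc k < n"
  shows "excess_sum E V (Suc k) = int (n * ((n - 2) choose k)) - int (n choose Suc k)"
proof -
  let ?A = "{W. W \<subseteq> V \<and> card W = Suc k}"
  let ?q = "\<lambda>W i. c i \<in> W \<and> c (Suc i mod n) \<notin> W"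
  have bij: "bij_betw c {..<n} V" using c by (simp add: cyclic_enum_def)
  have V: "finite V" "card V = n"
    using bij_betw_finite[OF bij] bij_betw_same_card[OF bij] by auto
  have finA: "finite ?A" using V(1) by (auto intro: finite_subset[of _ "Pow V"])
  have "(\<Sum>W\<in>?A. ncomp E W) = (\<Sum>W\<in>?A. card {i \<in> {..<n}. ?q W i})"
  proof (rule sum.cong[OF refl])
    fix W assume "W \<in> ?A"
    \<comment> \<open>The bound \<open>Suc k < n\<close> makes every such \<open>W\<close> proper,
      as counting by run ends requires.\<close>
    then have "W \<subseteq> V" "W \<noteq> V" using V n(2) by auto
    then show "ncomp E W = card {i \<in> {..<n}. ?q W i}"
      using ncomp_proper_subset[OF E c] by simp
  qed
  also have "\<dots> = (\<Sum>W\<in>?A. \<Sum>i<n. if ?q W i then 1 else 0)"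
    by (simp flip: sum.inter_filter)
  also have "\<dots> = (\<Sum>i<n. \<Sum>W\<in>?A. if ?q W i then 1 else 0)" by (rule sum.swap)
  also have "\<dots> = (\<Sum>i<n. (n - 2) choose k)"
  proof (rule sum.cong[OF refl])
    fix i assume "i \<in> {..<n}"
    then have i: "i < n" "Suc i mod n < n" "i \<noteq> Suc i mod n"
      using n by (auto simp: mod_Suc)
    then have "c i \<in> V" "c (Suc i mod n) \<in> V" "c i \<noteq> c (Suc i mod n)"
      using bij unfolding bij_betw_def inj_on_def by auto
    then have "card {W. W \<subseteq> V \<and> card W = Suc k \<and> ?q W i} = (n - 2) choose k"
      using card_subsets_containing_avoiding[OF V(1), of "c i" "c (Suc i mod n)" k] V(2) by simp
    moreover have "(\<Sum>W\<in>?A. if ?q W i then 1 else 0) = card {W \<in> ?A. ?q W i}"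
      using finA by (simp flip: sum.inter_filter)
    ultimately show "(\<Sum>W\<in>?A. if ?q W i then 1 else 0) = (n - 2) choose k"
      by (simp add: conj_assoc)
  qed
  finally have "(\<Sum>W\<in>?A. ncomp E W) = n * ((n - 2) choose k)" by simp
  moreover have "card ?A = n choose Suc k" using V(2) n_subsets[OF V(1)] by simp
  ultimately show ?thesis
    unfolding excess_sum_def sum_subtractf by (simp flip: of_nat_sum)
qed

lemma excess_sum_cycle_closed_form:
  assumes E: "symp E" and c: "cyclic_enum E c n V" and n: "n \<ge> 2"
  shows "real_of_int (excess_sum E V k) = (if k = n then 0
      else real n * (real k - 1) / (real n - real k) * real ((n - 2) choose k))"
proof -
  have bij: "bij_betw c {..<n} V" using c by (simp add: cyclic_enum_def)
  have V: "finite V" "card V = n"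
    using bij_betw_finite[OF bij] bij_betw_same_card[OF bij] by auto
  consider "k = 0" | "k = n" | "k > n" | j where "k = Suc j" "k < n"
    by (metis not0_implies_Suc linorder_neqE_nat)
  then show ?thesis
  proof cases
    case 1
    then show ?thesis using n excess_sum_0[OF V(1), of E] by simp
  next
    case 2
    have "{W. W \<subseteq> V \<and> card W = n} = {V}" using V card_subset_eq[OF V(1)] by auto
    then show ?thesis using 2 ncomp_whole_cycle[OF E c n] by (simp add: excess_sum_def)
  next
    case 3
    have none: "{W. W \<subseteq> V \<and> card W = k} = {}"
    proof -
      have "card W \<noteq> k" if "W \<subseteq> V" for W
        using card_mono[OF V(1) that] 3 V(2) by simp
      then show ?thesis by blast
    qed
    have "excess_sum E V k = 0" unfolding excess_sum_def none by simp
    then show ?thesis using 3 n by simp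
  next
    case 4
    obtain m where m: "n = Suc (Suc m)" using n by (metis Suc_le_D numeral_2_eq_2 Suc_le_mono)
    obtain q where q: "m = j + q" using 4 m le_Suc_ex[of j m] by auto
    \<comment> \<open>With \<open>m = n - 2\<close> and \<open>k = j + 1\<close>, absorption
      identities express both \<open>m choose Suc j\<close> and \<open>n choose Suc j\<close> as
      multiples of this common factor.\<close>
    let ?B = "real (m choose j)"
    have "Suc j * (m choose Suc j) = q * (m choose j)"
      using binomial_absorption[of j m] binomial_absorb_comp[of m j] q
      by (simp del: mult_Suc binomial_Suc_Suc)
    then have "real (Suc j) * real (m choose Suc j) = real q * ?B"
      by (simp only: flip: of_nat_mult)
    then have 1: "real (m choose Suc j) = real q * ?B / real (Suc j)"
      by (simp add: eq_divide_eq mult_ac del: of_nat_Suc binomial_Suc_Suc)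
    have "Suc j * (n choose Suc j) * Suc q = n * (Suc q * (Suc m choose j))"
      using binomial_absorption[of j n] m by (simp add: mult_ac del: mult_Suc mult_Suc_right binomial_Suc_Suc)
    also have "Suc q * (Suc m choose j) = Suc m * (m choose j)"
      using binomial_absorb_comp[of "Suc m" j] q by (simp add: mult_ac del: mult_Suc mult_Suc_right binomial_Suc_Suc)
    finally have "real (Suc j) * real (n choose Suc j) * real (Suc q) = real n * (real (Suc m) * ?B)"
      by (simp only: flip: of_nat_mult)
    then have 2: "real (n choose Suc j) = real n * real (Suc m) * ?B / (real (Suc j) * real (Suc q))"
      by (simp add: eq_divide_eq mult_ac del: of_nat_Suc binomial_Suc_Suc)
    have 3: "real n - real k = real (Suc q)" "n - 2 = m" "real k - 1 = real j"
      "real (Suc m) = real j + real q + 1"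
      using 4 m q by auto
    have "real_of_int (excess_sum E V k) = real n * ?B - real (n choose Suc j)"
      using excess_sum_cycle[OF E c n, of j] 4 3(2) by (simp del: binomial_Suc_Suc)
    also have "\<dots> = real n * real j / real (Suc q) * real (m choose Suc j)"
    proof -
      \<comment> \<open>Instantiated with \<open>a = j + 1\<close> and \<open>b = q + 1\<close>, so
        that \<open>a + b - 1\<close> is \<open>m + 1\<close> and \<open>b\<close> is
        \<open>n - k\<close>.\<close>
      have "x * y - x * (a + b - 1) * y / (a * b) = x * (a - 1) / b * ((b - 1) * y / a)"
        if "a \<noteq> 0" "b \<noteq> 0" for a b x y :: real
        using that by (simp add: field_simps)
      from this[of "real (Suc j)" "real (Suc q)" "real n" ?B] show ?thesis
        unfolding 1 2 3(4) by (simp add: algebra_simps del: binomial_Suc_Suc)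
    qed
    finally show ?thesis using 4(2) unfolding 3(1-3) 4(1)[symmetric] by simp
  qed
qed

section \<open>Stacked polytopes\<close>

lemma symp_vertex_adjacent: "symp (vertex_adjacent P)"
  by (rule sympI) (simp add: vertex_adjacent_commute)

lemma betti_b_boundary_complex:
  fixes P :: "'a::euclidean_space set"
  assumes "simplicial_polytope P" "card (vertex_set P) \<ge> 3"
  shows "betti_b k (vertex_set P) (boundary_complex P) =
    excess_sum (vertex_adjacent P) (vertex_set P) k"
  unfolding betti_b_def excess_sum_def
proof (rule sum.cong[OF refl])
  fix W assume W: "W \<in> {W. W \<subseteq> vertex_set P \<and> card W = k}"
  have "nc (boundary_complex P) W = ncomp (vertex_adjacent P) W"
    using restriction_boundary_complex_pair[OF assms] W
    by (intro nc_eq_ncomp[OF symp_vertex_adjacent]) auto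
  then show "int (nc (boundary_complex P) W) - 1 = int (ncomp (vertex_adjacent P) W) - 1" by simp
qed

lemma (in simplex_gluing) card_vertex_set_union:
  "card (vertex_set (P \<union> S)) = Suc (card (vertex_set P))"
  using vertex_set_union apex_notin(1) polytope_finite_vertex_set[OF polytope_P] by simp

text \<open>Provides what \<open>simplex_gluing\<close> asks of \<open>P\<close> at each step, and a
  vertex bound that keeps the natural-number difference \<open>n - d\<close> from being
  truncated.\<close>

lemma stacked_polytope_invariant:
  fixes P :: "'a::euclidean_space set"
  assumes "stacked_polytope d P"
  shows "simplicial_polytope P \<and> aff_dim P = int d \<and> card (vertex_set P) \<ge> Suc d"
  using assms
proof induction
  case (simplex P)
  then show ?case
    using simplex_imp_simplicial_polytope aff_dim_simplex simplex_vertex_set(2)[OF simplex] by force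
next
  case (attach P F S)
  then interpret simplex_gluing P S F d
    by unfold_locales (auto simp: simplicial_polytope_def)
  show ?case using dim_union simplicial_union card_vertex_set_union attach.IH by simp
qed

lemma stacked_polytope_gluing:
  assumes "stacked_polytope d P" "F facet_of P" "int d simplex S" "F facet_of S" "P \<inter> S = F"
    "simplicial_polytope (P \<union> S)" "vertex_set (P \<union> S) = vertex_set P \<union> vertex_set S"
  shows "simplex_gluing P S F d"
  using assms stacked_polytope_invariant[OF assms(1)]
  by unfold_locales (auto simp: simplicial_polytope_def)

lemma simplex_vertex_adjacent:
  fixes P :: "'a::euclidean_space set"
  assumes "n simplex P" "x \<in> vertex_set P" "y \<in> vertex_set P"
  shows "vertex_adjacent P x y"
  unfolding vertex_adjacent_def using simplex_subset_face[OF assms(1)] assms(2,3) by simp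

section \<open>Dimension at least three\<close>

lemma excess_sum_stacked_polytope:
  fixes P :: "'a::euclidean_space set"
  assumes "stacked_polytope d P" and d: "d \<ge> 3"
  shows "excess_sum (vertex_adjacent P) (vertex_set P) k =
    (int k - 1) * int ((card (vertex_set P) - d) choose k)"
  using assms(1)
proof (induction arbitrary: k)
  case (simplex P)
  have fin: "finite (vertex_set P)"
    using simplex simplex_imp_polytope polytope_finite_vertex_set by blast
  \<comment> \<open>Thus the right side is \<open>-1\<close> for \<open>k = 0\<close>; for
    \<open>k = 1\<close> the factor \<open>k - 1\<close> vanishes, and for larger \<open>k\<close>
    the binomial coefficient does.\<close>
  have card: "card (vertex_set P) - d = 1" using simplex_vertex_set(2)[OF simplex] by simp
  show ?case
  proof (cases k)
    case 0
    then show ?thesis using excess_sum_0[OF fin, of "vertex_adjacent P"] by simp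
  next
    case (Suc j)
    then show ?thesis
      using excess_sum_complete[OF simplex_vertex_adjacent[OF simplex]] card
      by (cases j) auto
  qed
next
  case (attach P F S)
  interpret simplex_gluing P S F d
    by (rule stacked_polytope_gluing[OF attach.hyps])
  let ?V = "vertex_set P" and ?C = "vertex_set F" and ?E = "vertex_adjacent (P \<union> S)"
  have fin: "finite ?V" by (rule polytope_finite_vertex_set[OF polytope_P])
  have C: "?C \<subseteq> ?V" using vertex_set_facet(1) by blast
  \<comment> \<open>A facet has \<open>d \<ge> 3\<close> vertices and so is not an edge: no old
    adjacency is lost.\<close>
  have noedge: "?C \<noteq> {x, y}" for x y
    using card_vertex_set_facet d card_insert_le_m1[of 2 "{y}" x] by auto
  have old: "?E x y \<longleftrightarrow> vertex_adjacent P x y" if "x \<in> ?V" "y \<in> ?V" for x y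
    using vertex_adjacent_union[OF _ that] noedge d by simp
  have V': "vertex_set (P \<union> S) = insert apex ?V" by (rule vertex_set_union)
  show ?case
  proof (cases k)
    case 0
    then show ?thesis using V' fin by (simp add: excess_sum_0)
  next
    case (Suc j)
    have le: "d < card ?V" using stacked_polytope_invariant[OF attach.hyps(1)] by simp
    have eq: "excess_sum ?E ?V i = (int i - 1) * int ((card ?V - d) choose i)" for i
      using excess_sum_cong[of ?V ?E "vertex_adjacent P" i] old attach.IH by simp
    have "excess_sum ?E (insert apex ?V) (Suc j) =
        excess_sum ?E ?V (Suc j) + excess_sum ?E ?V j + int ((card ?V - card ?C) choose j)"
    proof (rule excess_sum_insert_clique[OF symp_vertex_adjacent fin apex_notin(1) C])
      show "?E x y" if "x \<in> ?C" "y \<in> ?C" for x y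
        using old vertex_adjacent_facet that C by blast
      show "?E apex x \<longleftrightarrow> x \<in> ?C" if "x \<in> ?V" for x
        using vertex_adjacent_apex[OF _ that] d that vertex_set_facet(1) by simp
    qed
    moreover have "card (vertex_set (P \<union> S)) - d = Suc (card ?V - d)"
      using card_vertex_set_union le by simp
    \<comment> \<open>With \<open>e = card ?V - d\<close>, the terms
      \<open>(j - 1) * (e choose j)\<close> and \<open>e choose j\<close> add up to
      \<open>j * (e choose j)\<close>, and Pascal's rule combines this with
      \<open>j * (e choose Suc j)\<close>.\<close>
    ultimately show ?thesis
      unfolding V' Suc eq card_vertex_set_facet by (simp add: algebra_simps)
  qed
qed

section \<open>Dimension two\<close>

lemma cyclic_enum_triangle:
  assumes "card V = 3" "\<And>x y. x \<in> V \<Longrightarrow> y \<in> V \<Longrightarrow> E x y"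
  shows "\<exists>c. cyclic_enum E c 3 V"
proof -
  have "finite V" using assms(1) by (simp add: card_ge_0_finite)
  then obtain c where c: "bij_betw c {..<3::nat} V"
    using ex_bij_betw_nat_finite[of V] unfolding assms(1) atLeast0LessThan by blast
  have "E (c i) (c j) \<longleftrightarrow> j = Suc i mod 3 \<or> i = Suc j mod 3"
    if ij: "i < 3" "j < 3" "i \<noteq> j" for i j
  proof -
    have "E (c i) (c j)" by (rule assms(2)) (use bij_betwE[OF c] ij in auto)
    moreover have "i \<in> {0, 1, 2}" "j \<in> {0, 1, 2}" using ij(1,2) by auto
    then have "j = Suc i mod 3 \<or> i = Suc j mod 3" using ij(3) by auto
    ultimately show ?thesis by blast
  qed
  then show ?thesis using c unfolding cyclic_enum_def by blast
qed

text \<open>A triangle is a 3-cycle. An attaching step deletes the edge \<open>F\<close> and joins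
  its two ends to the apex, which subdivides that edge of the cycle.\<close>

lemma stacked_polygon_cyclic_enum:
  fixes P :: "'a::euclidean_space set"
  assumes "stacked_polytope d P" and d: "d = 2"
  shows "\<exists>c. cyclic_enum (vertex_adjacent P) c (card (vertex_set P)) (vertex_set P)"
  using assms(1)
proof induction
  case (simplex P)
  have card: "card (vertex_set P) = 3" using simplex_vertex_set(2)[OF simplex] d by simp
  show ?case
    unfolding card by (rule cyclic_enum_triangle[OF card simplex_vertex_adjacent[OF simplex]])
next
  case (attach P F S)
  interpret simplex_gluing P S F d
    by (rule stacked_polytope_gluing[OF attach.hyps])
  let ?V = "vertex_set P"
  obtain f g where fg: "vertex_set F = {f, g}" "f \<noteq> g"
    using card_vertex_set_facet d by (auto simp: card_2_iff)
  then have V: "f \<in> ?V" "g \<in> ?V" using vertex_set_facet(1) by blast+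
  obtain c where c: "cyclic_enum (vertex_adjacent P) c (card ?V) ?V" using attach.IH by blast
  obtain c' where
    "cyclic_enum (vertex_adjacent (P \<union> S)) c' (Suc (card ?V)) (insert apex ?V)"
  proof (rule cyclic_enum_subdivide[OF symp_vertex_adjacent c _ V fg(2) _ apex_notin(1)])
    show "card ?V \<ge> 3" using stacked_polytope_invariant[OF attach.hyps(1)] d by simp
    show "vertex_adjacent P f g" using vertex_adjacent_facet fg(1) by simp
    show "vertex_adjacent (P \<union> S) x y \<longleftrightarrow> vertex_adjacent P x y \<and> {f, g} \<noteq> {x, y}"
      if "x \<in> ?V" "y \<in> ?V" for x y
      using vertex_adjacent_union[OF _ that] d fg(1) by simp
    show "vertex_adjacent (P \<union> S) apex x \<longleftrightarrow> x \<in> {f, g}" if "x \<in> ?V" for x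
      using vertex_adjacent_apex[OF _ that] d that vertex_set_facet(1) fg(1) by auto
  qed
  then show ?case
    unfolding vertex_set_union[symmetric] card_vertex_set_union[symmetric] by blast
qed

theorem theorem3p9:
  fixes P :: "'a::euclidean_space set" and d n :: nat
  assumes "stacked_polytope d P"
    and "card (vertex_set P) = n"
  shows "(d \<ge> 3 \<longrightarrow>
            (\<forall>k::nat. betti_b k (vertex_set P) (boundary_complex P)
                        = (int k - 1) * int ((n - d) choose k))) \<and>
         (d = 2 \<longrightarrow>
            (\<forall>k::nat. real_of_int (betti_b k (vertex_set P) (boundary_complex P))
                        = (if k = n then 0
                           else real n * (real k - 1) / (real n - real k) * real ((n - 2) choose k))))"
proof (intro conjI impI allI)
  have inv: "simplicial_polytope P" "card (vertex_set P) \<ge> Suc d"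
    using stacked_polytope_invariant[OF assms(1)] by auto
  \<comment> \<open>For \<open>d \<ge> 2\<close> there are at least three vertices, so an edge is
    never the whole vertex set.\<close>
  have betti: "betti_b k (vertex_set P) (boundary_complex P) =
      excess_sum (vertex_adjacent P) (vertex_set P) k" if "d \<ge> 2" for k
    using betti_b_boundary_complex[OF inv(1)] inv(2) that by simp
  show "betti_b k (vertex_set P) (boundary_complex P) = (int k - 1) * int ((n - d) choose k)"
    if "d \<ge> 3" for k
    using excess_sum_stacked_polytope[OF assms(1) that, of k] betti[of k] that assms(2) by simp
  show "real_of_int (betti_b k (vertex_set P) (boundary_complex P)) = (if k = n then 0
      else real n * (real k - 1) / (real n - real k) * real ((n - 2) choose k))" if d: "d = 2" for k
  proof -
    obtain c where "cyclic_enum (vertex_adjacent P) c n (vertex_set P)"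
      using stacked_polygon_cyclic_enum assms d by blast
    then show ?thesis
      using excess_sum_cycle_closed_form[OF symp_vertex_adjacent, of P c n "vertex_set P" k]
        betti[of k] inv(2) assms(2) d by simp
  qed
qed

end
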